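(* Let $r \geq 2$ and $m,k\geq r$ be integers, and let $G$ be an $r$-graph on $n$ vertices with $\delta(G)\ge (1-d)n$, where $d \leq \frac{1}{(2e^2k)^{r-1}}$. If $\mathcal{H}$ is the set of induced subgraphs $H$ of $G$ with exactly $k$ vertices such that $\Delta_1(\bar{H})\le m$, then $G$ has a $k\cdot \left((2 e^2 k)^{r-1} d\right)^{(m^{1/(r-1)}-r)/(r-1)}$-almost fractional $\mathcal{H}$-decomposition.
   Context: An $r$-graph is an $r$-uniform hypergraph. Here $\delta(G)$ denotes the minimum $(r-1)$-degree of $G$: the minimum over all $(r-1)$-subsets $S$ of $V(G)$ of the number of edges of $G$ containing $S$. For an induced subgraph $H$ of $G$, $\bar H$ is its complement, i.e. the $r$-graph on $V(H)$ whose edges are the $r$-subsets of $V(H)$ that are not edges of $H$, and $\Delta_1(\bar H)$ is the maximum number of edges of $\bar H$ containing a single vertex. For a family $\mathcal{H}$ of subgraphs of $G$, a fractional $\mathcal{H}$-packing is an assignment $\phi$ of non-negative real weights to the elements of $\mathcal{H}$ such that for every edge $e$ of $G$, $\partial\phi(e):=\sum_{H\in\mathcal{H}: e\in H}\phi(H)\in[0,1]$; for $\eta\in[0,1]$ it is an $\eta$-almost fractional $\mathcal{H}$-decomposition if $\partial\phi(e)\in[1-\eta,1]$ for every edge $e$ of $G$. *)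

theory Defs
  imports Complex_Main
begin

record 'a hypergraph =
  verts :: "'a set"
  edges :: "'a set set"

definition r_graph :: "nat \<Rightarrow> 'a hypergraph \<Rightarrow> bool" where
  "r_graph r G \<longleftrightarrow> finite (verts G) \<and> (\<forall>e\<in>edges G. e \<subseteq> verts G \<and> card e = r)"

definition degree :: "'a hypergraph \<Rightarrow> 'a set \<Rightarrow> nat" where
  "degree G S = card {e \<in> edges G. S \<subseteq> e}"

(* The values of the next two are unspecified (Min {}, Max {}) if the graph has fewer than
   j vertices. An r-graph with fewer than r - 1 vertices has no edges. *)
definition min_degree :: "nat \<Rightarrow> 'a hypergraph \<Rightarrow> nat" where
  "min_degree j G = Min (degree G ` {S. S \<subseteq> verts G \<and> card S = j})"

definition max_degree :: "nat \<Rightarrow> 'a hypergraph \<Rightarrow> nat" where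
  "max_degree j G = Max (degree G ` {S. S \<subseteq> verts G \<and> card S = j})"

definition complement :: "nat \<Rightarrow> 'a hypergraph \<Rightarrow> 'a hypergraph" where
  "complement r H = \<lparr>verts = verts H, edges = {e. e \<subseteq> verts H \<and> card e = r \<and> e \<notin> edges H}\<rparr>"

definition induced_subgraph :: "'a hypergraph \<Rightarrow> 'a hypergraph \<Rightarrow> bool" where
  "induced_subgraph H G \<longleftrightarrow>
     verts H \<subseteq> verts G \<and> edges H = {e \<in> edges G. e \<subseteq> verts H}"

definition edge_weight :: "'a hypergraph set \<Rightarrow> ('a hypergraph \<Rightarrow> real) \<Rightarrow> 'a set \<Rightarrow> real" where
  "edge_weight \<H> \<phi> e = (\<Sum>H\<in>{H \<in> \<H>. e \<in> edges H}. \<phi> H)"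

definition fractional_packing ::
    "'a hypergraph \<Rightarrow> 'a hypergraph set \<Rightarrow> ('a hypergraph \<Rightarrow> real) \<Rightarrow> bool" where
  "fractional_packing G \<H> \<phi> \<longleftrightarrow>
     (\<forall>H\<in>\<H>. 0 \<le> \<phi> H) \<and> (\<forall>e\<in>edges G. edge_weight \<H> \<phi> e \<in> {0..1})"

(* The usual range of \<eta> is [0,1], but it is not imposed: for \<eta> > 1 the lower bound is void. *)
definition almost_fractional_decomposition ::
    "real \<Rightarrow> 'a hypergraph \<Rightarrow> 'a hypergraph set \<Rightarrow> ('a hypergraph \<Rightarrow> real) \<Rightarrow> bool" where
  "almost_fractional_decomposition \<eta> G \<H> \<phi> \<longleftrightarrow>
     fractional_packing G \<H> \<phi> \<and> (\<forall>e\<in>edges G. edge_weight \<H> \<phi> e \<in> {1 - \<eta>..1})"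

end

theory Submission
  imports Defs "HOL-Library.FuncSet"
begin

text \<open>
  The weight \<open>1 / (n - r choose k - r)\<close> on every \<open>k\<close>-subset of the vertices gives each edge weight
  exactly 1, so after restricting it to \<open>\<H>\<close> the defect at an edge \<open>e\<close> is the probability that a
  random \<open>k\<close>-set \<open>K\<close> containing \<open>e\<close> has a vertex \<open>v\<close> of complement degree above \<open>m\<close>. The
  non-edges at \<open>v\<close> inside \<open>K\<close> then cover more than \<open>t = m powr (1 / (r - 1))\<close> vertices other
  than \<open>v\<close>, so one can pick greedily \<open>s \<ge> (t - r) / (r - 1)\<close> of them, each containing a vertex
  outside \<open>e\<close> and the previous ones. By the degree condition each of these steps costs a factor
  \<open>d * k * (k choose r - 2) \<le> d * k ^ (r - 1)\<close>; a union bound over the \<open>k\<close> choices of \<open>v\<close>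
  finishes the proof.
\<close>

section \<open>Counting the \<open>k\<close>-sets between two given sets\<close>

text \<open>The sample space of a random \<open>k\<close>-set conditioned on containing
  \<open>X\<close>; quotients of its cardinalities stand in for probabilities.\<close>

definition supersets :: "'a set \<Rightarrow> nat \<Rightarrow> 'a set \<Rightarrow> 'a set set" where
  "supersets V k X = {K. X \<subseteq> K \<and> K \<subseteq> V \<and> card K = k}"

lemma finite_supersets [simp]: "finite V \<Longrightarrow> finite (supersets V k X)"
  unfolding supersets_def by (rule finite_subset[of _ "Pow V"]) auto

lemma card_supersets:
  assumes "finite V" "X \<subseteq> V" "card X \<le> k"
  shows "card (supersets V k X) = (card V - card X) choose (k - card X)"
proof -
  have fX: "finite X" using assms finite_subset by blast
  have "bij_betw (\<lambda>K. K - X) (supersets V k X) {Y. Y \<subseteq> V - X \<and> card Y = k - card X}"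
  proof (rule bij_betwI[where g = "\<lambda>Y. Y \<union> X"])
    show "(\<lambda>K. K - X) \<in> supersets V k X \<rightarrow> {Y. Y \<subseteq> V - X \<and> card Y = k - card X}"
      using fX by (auto simp: supersets_def card_Diff_subset)
    show "(\<lambda>Y. Y \<union> X) \<in> {Y. Y \<subseteq> V - X \<and> card Y = k - card X} \<rightarrow> supersets V k X"
    proof
      fix Y assume "Y \<in> {Y. Y \<subseteq> V - X \<and> card Y = k - card X}"
      moreover from this have "finite Y" using assms(1) finite_subset by blast
      ultimately have "card (Y \<union> X) = k"
        using fX assms(3) by (subst card_Un_disjoint) auto
      then show "Y \<union> X \<in> supersets V k X"
        using \<open>Y \<in> _\<close> assms(2) by (auto simp: supersets_def)
    qed
  qed (auto simp: supersets_def)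
  then have "card (supersets V k X) = card {Y. Y \<subseteq> V - X \<and> card Y = k - card X}"
    by (rule bij_betw_same_card)
  also have "\<dots> = card (V - X) choose (k - card X)"
    using assms by (intro n_subsets) auto
  finally show ?thesis using assms fX by (simp add: card_Diff_subset)
qed

lemma supersets_empty:
  assumes "finite V" "k < card X"
  shows "supersets V k X = {}"
proof -
  have "card K \<noteq> k" if "X \<subseteq> K" "K \<subseteq> V" for K
    using card_mono[of K X] that assms finite_subset[of K V] by auto
  then show ?thesis by (auto simp: supersets_def)
qed

text \<open>For |X| < k, a random \<open>k\<close>-set containing \<open>X\<close> also contains
  \<open>w\<close> with probability (k - |X|) / (n - |X|), where n = |V|. This is at most k / n
  because k \<le> n. Cross-multiplying keeps the inequality in the natural numbers.\<close>

lemma card_supersets_insert: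
  assumes "finite V" "X \<subseteq> V" "w \<in> V" "w \<notin> X" "k \<le> card V"
  shows "card V * card (supersets V k (insert w X)) \<le> k * card (supersets V k X)"
proof (cases "card X < k")
  case True
  have fX: "finite X" using assms finite_subset by blast
  have "insert w X \<subseteq> V" using assms by auto
  then have "card (insert w X) \<le> card V" using assms(1) card_mono by blast
  then have lt: "card X < card V" using fX assms(4) by simp
  define a b where "a = card V - Suc (card X)" and "b = k - Suc (card X)"
  have a: "card V = Suc a + card X" and b: "k = Suc b + card X" using lt True by (auto simp: a_def b_def)
  have N': "card (supersets V k (insert w X)) = a choose b"
    using assms fX True by (subst card_supersets) (simp_all add: a_def b_def)
  have N: "card (supersets V k X) = Suc a choose Suc b"
    using assms(1,2) True a b by (subst card_supersets) simp_all
  have "card V * (a choose b) = Suc b * (Suc a choose Suc b) + card X * (a choose b)"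
    unfolding a add_mult_distrib Suc_times_binomial ..
  also have "\<dots> \<le> Suc b * (Suc a choose Suc b) + card X * (Suc a choose Suc b)"
    by (intro add_left_mono mult_le_mono2) simp
  also have "\<dots> = k * (Suc a choose Suc b)"
    unfolding b add_mult_distrib ..
  finally show ?thesis unfolding N N' .
next
  case False
  then have "supersets V k (insert w X) = {}"
    using assms finite_subset[of X V] by (intro supersets_empty) auto
  then show ?thesis by simp
qed

text \<open>Double counting of the pairs of \<open>g\<close> in \<open>P\<close> and
  \<open>K\<close> with \<open>g \<subseteq> K\<close>.\<close>

lemma sum_card_supersets:
  assumes "finite V" "finite P" "\<And>K. K \<in> supersets V k X \<Longrightarrow> card {g \<in> P. g \<subseteq> K} = c"
  shows "(\<Sum>g\<in>P. card (supersets V k (X \<union> g))) = c * card (supersets V k X)"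
proof -
  have "supersets V k (X \<union> g) = {K \<in> supersets V k X. g \<subseteq> K}" for g
    by (auto simp: supersets_def)
  then show ?thesis
    using sum_multicount[of P "supersets V k X" "\<lambda>g K. g \<subseteq> K" c] assms by simp
qed

text \<open>Bounds the expected number of members of \<open>L\<close> that lie in a random
  \<open>K\<close> containing \<open>X\<close> but not in \<open>X\<close> itself. Such a member is
  \<open>insert w g\<close> with \<open>w\<close> outside \<open>X\<close>. Given \<open>g\<close>,
  there are at most d * n choices of \<open>w\<close>, each present with probability at most k / n,
  and \<open>K\<close> contains \<open>k choose j\<close> sets \<open>g\<close>.\<close>

lemma sum_card_supersets_edges:
  fixes d :: real
  assumes V: "finite V" "X \<subseteq> V" "k \<le> card V" "V \<noteq> {}"
    and L: "\<And>f. f \<in> L \<Longrightarrow> f \<subseteq> V \<and> card f = Suc j"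
    and deg: "\<And>g. g \<subseteq> V \<Longrightarrow> card g = j \<Longrightarrow>
                real (card {w \<in> V - g. insert w g \<in> L}) \<le> d * real (card V)"
  shows "(\<Sum>f\<in>{f \<in> L. \<not> f \<subseteq> X}. real (card (supersets V k (X \<union> f))))
           \<le> d * real (k * (k choose j)) * real (card (supersets V k X))"
proof -
  define P where "P = {g. g \<subseteq> V \<and> card g = j}"
  define A where "A = (\<lambda>g. {w \<in> V - (X \<union> g). insert w g \<in> L})"
  let ?N = "\<lambda>Y. real (card (supersets V k Y))"
  have fP: "finite P" unfolding P_def using V by auto
  have fA: "finite (A g)" for g unfolding A_def using V by auto
  have fL: "finite L" by (rule finite_subset[of _ "Pow V"]) (use L V in auto)
  have n0: "card V > 0" using V by (simp add: card_gt_0_iff)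
  have "(\<Sum>f\<in>{f \<in> L. \<not> f \<subseteq> X}. ?N (X \<union> f))
      \<le> (\<Sum>(g,w)\<in>Sigma P A. ?N (insert w (X \<union> g)))"
  \<comment> \<open>One \<open>f\<close> may come from several pairs \<open>(g, w)\<close>, so the
    right-hand sum may overcount. Taking \<open>w\<close> in \<open>f - X\<close> puts it outside
    \<open>X \<union> g\<close>, as \<open>card_supersets_insert\<close> requires.\<close>
  proof (rule sum_le_included[where i = "\<lambda>(g,w). insert w g"])
    show "\<forall>f\<in>{f \<in> L. \<not> f \<subseteq> X}. \<exists>y\<in>Sigma P A. (case y of (g,w) \<Rightarrow> insert w g) = f \<and>
        ?N (X \<union> f) \<le> (case y of (g,w) \<Rightarrow> ?N (insert w (X \<union> g)))"
    proof
      fix f assume "f \<in> {f \<in> L. \<not> f \<subseteq> X}"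
      then obtain w where w: "f \<in> L" "w \<in> f" "w \<notin> X" by auto
      then have fV: "f \<subseteq> V" "card f = Suc j" using L by auto
      have "finite f" using fV V finite_subset by blast
      then have "f - {w} \<in> P" using fV w by (auto simp: P_def)
      moreover have "insert w (f - {w}) = f" using w by auto
      moreover have "insert w (X \<union> (f - {w})) = X \<union> f" using w by auto
      moreover have "w \<in> A (f - {w})" using w fV \<open>insert w (f - {w}) = f\<close> by (auto simp: A_def)
      ultimately show "\<exists>y\<in>Sigma P A. (case y of (g,w) \<Rightarrow> insert w g) = f \<and>
        ?N (X \<union> f) \<le> (case y of (g,w) \<Rightarrow> ?N (insert w (X \<union> g)))"
        by (intro bexI[of _ "(f - {w}, w)"]) auto
    qed
  qed (use fP fA fL in auto)
  also have "\<dots> = (\<Sum>g\<in>P. \<Sum>w\<in>A g. ?N (insert w (X \<union> g)))"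
    using fP fA by (simp add: sum.Sigma)
  also have "\<dots> \<le> (\<Sum>g\<in>P. d * real k * ?N (X \<union> g))"
  proof (rule sum_mono)
    fix g assume g: "g \<in> P"
    have "(\<Sum>w\<in>A g. ?N (insert w (X \<union> g))) \<le> (\<Sum>w\<in>A g. real k * ?N (X \<union> g) / real (card V))"
    proof (rule sum_mono)
      fix w assume "w \<in> A g"
      then have "card V * card (supersets V k (insert w (X \<union> g))) \<le> k * card (supersets V k (X \<union> g))"
        using V g by (intro card_supersets_insert) (auto simp: A_def P_def)
      then have "real (card V) * ?N (insert w (X \<union> g)) \<le> real k * ?N (X \<union> g)"
        by (metis of_nat_le_iff of_nat_mult)
      then show "?N (insert w (X \<union> g)) \<le> real k * ?N (X \<union> g) / real (card V)"
        using n0 by (simp add: field_simps)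
    qed
    also have "\<dots> = real (card (A g)) * (real k * ?N (X \<union> g) / real (card V))" by simp
    also have "\<dots> \<le> (d * real (card V)) * (real k * ?N (X \<union> g) / real (card V))"
    proof (rule mult_right_mono)
      have "card (A g) \<le> card {w \<in> V - g. insert w g \<in> L}"
        using V by (intro card_mono) (auto simp: A_def)
      then show "real (card (A g)) \<le> d * real (card V)"
        using deg[of g] g by (auto simp: P_def)
    qed simp
    also have "\<dots> = d * real k * ?N (X \<union> g)" using n0 by simp
    finally show "(\<Sum>w\<in>A g. ?N (insert w (X \<union> g))) \<le> d * real k * ?N (X \<union> g)" .
  qed
  also have "\<dots> = d * real k * real (\<Sum>g\<in>P. card (supersets V k (X \<union> g)))"
    by (simp add: sum_distrib_left)
  also have "(\<Sum>g\<in>P. card (supersets V k (X \<union> g))) = (k choose j) * card (supersets V k X)"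
  proof (rule sum_card_supersets)
    fix K assume "K \<in> supersets V k X"
    then have K: "K \<subseteq> V" "card K = k" by (auto simp: supersets_def)
    then have "{g \<in> P. g \<subseteq> K} = {g. g \<subseteq> K \<and> card g = j}" by (auto simp: P_def)
    then show "card {g \<in> P. g \<subseteq> K} = k choose j"
      using n_subsets[of K j] K V finite_subset by metis
  qed (use V fP in auto)
  finally show ?thesis by (simp add: mult_ac)
qed

section \<open>Chains of edges, each reaching a new vertex\<close>

text \<open>The set \<open>X\<close> is both what is already covered and what \<open>K\<close> is
  known to contain. Enlarging it by \<open>f\<close> makes the rest of a chain an event conditioned
  on the larger set.\<close>

primrec edge_chain :: "'a set set \<Rightarrow> 'a set \<Rightarrow> nat \<Rightarrow> 'a set \<Rightarrow> bool" where
  "edge_chain L K 0 X \<longleftrightarrow> True"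
| "edge_chain L K (Suc s) X \<longleftrightarrow> (\<exists>f\<in>L. f \<subseteq> K \<and> \<not> f \<subseteq> X \<and> edge_chain L K s (X \<union> f))"

text \<open>Union bound over the first edge \<open>f\<close> of the chain. As
  \<open>f \<subseteq> K\<close>, the set \<open>K\<close> is a superset of
  \<open>X \<union> f\<close>, where the induction hypothesis applies; summing over \<open>f\<close>
  costs one more factor by \<open>sum_card_supersets_edges\<close>.\<close>

lemma card_edge_chain_le:
  fixes d :: real
  assumes V: "finite V" "k \<le> card V" "V \<noteq> {}" "d \<ge> 0"
    and L: "\<And>f. f \<in> L \<Longrightarrow> f \<subseteq> V \<and> card f = Suc j"
    and deg: "\<And>g. g \<subseteq> V \<Longrightarrow> card g = j \<Longrightarrow>
                real (card {w \<in> V - g. insert w g \<in> L}) \<le> d * real (card V)"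
    and "X \<subseteq> V"
  shows "real (card {K \<in> supersets V k X. edge_chain L K s X})
           \<le> (d * real (k * (k choose j))) ^ s * real (card (supersets V k X))"
  using \<open>X \<subseteq> V\<close>
proof (induction s arbitrary: X)
  case 0
  then show ?case by simp
next
  case (Suc s)
  let ?q = "d * real (k * (k choose j))"
  let ?B = "\<lambda>X. {K \<in> supersets V k X. edge_chain L K s X}"
  define F where "F = {f \<in> L. \<not> f \<subseteq> X}"
  have fL: "finite F" unfolding F_def by (rule finite_subset[of _ "Pow V"]) (use L V in auto)
  have "{K \<in> supersets V k X. edge_chain L K (Suc s) X} \<subseteq> (\<Union>f\<in>F. ?B (X \<union> f))"
    by (auto simp: supersets_def F_def)
  then have "card {K \<in> supersets V k X. edge_chain L K (Suc s) X} \<le> card (\<Union>f\<in>F. ?B (X \<union> f))"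
    using fL V by (intro card_mono) auto
  also have "\<dots> \<le> (\<Sum>f\<in>F. card (?B (X \<union> f)))" by (rule card_UN_le[OF fL])
  finally have "real (card {K \<in> supersets V k X. edge_chain L K (Suc s) X})
      \<le> (\<Sum>f\<in>F. real (card (?B (X \<union> f))))"
    unfolding of_nat_sum[symmetric] of_nat_le_iff .
  also have "\<dots> \<le> (\<Sum>f\<in>F. ?q ^ s * real (card (supersets V k (X \<union> f))))"
  proof (rule sum_mono, rule Suc.IH)
    show "X \<union> f \<subseteq> V" if "f \<in> F" for f using that L Suc.prems by (auto simp: F_def)
  qed
  also have "\<dots> = ?q ^ s * (\<Sum>f\<in>F. real (card (supersets V k (X \<union> f))))"
    by (simp add: sum_distrib_left)
  also have "\<dots> \<le> ?q ^ s * (?q * real (card (supersets V k X)))"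
  proof (rule mult_left_mono)
    show "(\<Sum>f\<in>F. real (card (supersets V k (X \<union> f)))) \<le> ?q * real (card (supersets V k X))"
      unfolding F_def by (rule sum_card_supersets_edges[OF V(1) Suc.prems V(2,3) L deg])
    show "0 \<le> ?q ^ s" using V(4) by simp
  qed
  also have "\<dots> = ?q ^ Suc s * real (card (supersets V k X))"
    by (simp only: power_Suc2 mult.assoc)
  finally show ?case .
qed

text \<open>While some vertex of the union is uncovered, an edge through it extends the chain, and
  each edge covers at most \<open>c\<close> new vertices. Hence more than c * (s - 1) uncovered
  vertices suffice; the \<open>+ c\<close> on the right avoids truncated subtraction.\<close>

lemma edge_chain_greedy:
  assumes "finite (\<Union>{f \<in> L. f \<subseteq> K})" "\<And>f. f \<in> L \<Longrightarrow> card f = c"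
    and "c * s < card (\<Union>{f \<in> L. f \<subseteq> K} - X) + c"
  shows "edge_chain L K s X"
  using assms(3)
proof (induction s arbitrary: X)
  case (Suc s)
  let ?U = "\<Union>{f \<in> L. f \<subseteq> K}"
  have "card (?U - X) > 0" using Suc.prems by simp
  then obtain f where f: "f \<in> L" "f \<subseteq> K" "\<not> f \<subseteq> X" by (auto simp: card_gt_0_iff)
  have ff: "finite f" using f assms(1) finite_subset[of f ?U] by blast
  have "card (?U - X) - card f \<le> card (?U - X - f)"
    using ff by (rule diff_card_le_card_Diff)
  also have "?U - X - f = ?U - (X \<union> f)" by auto
  finally have "card (?U - X) \<le> card (?U - (X \<union> f)) + c" using assms(2)[OF f(1)] by simp
  then have "edge_chain L K s (X \<union> f)" using Suc.prems by (intro Suc.IH) simp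
  then show ?case using f by auto
qed simp

section \<open>Non-edges at a vertex and the chains they contain\<close>

lemma card_uniform_le_power:
  assumes "finite U" "\<And>f. f \<in> F \<Longrightarrow> f \<subseteq> U \<and> card f = c"
  shows "card F \<le> card U ^ c"
proof -
  have "card F \<le> card {f. f \<subseteq> U \<and> card f = c}"
    using assms by (intro card_mono) auto
  also have "\<dots> = card U choose c" using assms by (simp add: n_subsets)
  also have "\<dots> \<le> card U ^ c" by (cases "c \<le> card U") (auto intro: binomial_le_pow simp: binomial_eq_0)
  finally show ?thesis .
qed

text \<open>The edges containing \<open>S\<close> correspond to vertices outside \<open>S\<close>.
  The summand \<open>r - 1\<close> for \<open>S\<close> itself is kept because it later bounds
  \<open>d * n\<close> from below.\<close>

lemma card_non_neighbours_le:
  assumes "r_graph r G" "S \<subseteq> verts G" "card S = r - 1" "r > 0"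
  shows "card {w \<in> verts G - S. insert w S \<notin> edges G} + min_degree (r - 1) G + (r - 1)
           \<le> card (verts G)"
proof -
  let ?V = "verts G"
  let ?A = "{w \<in> ?V - S. insert w S \<in> edges G}"
  let ?B = "{w \<in> ?V - S. insert w S \<notin> edges G}"
  have fV: "finite ?V" and E: "\<And>e. e \<in> edges G \<Longrightarrow> e \<subseteq> ?V \<and> card e = r"
    using assms(1) by (auto simp: r_graph_def)
  have fS: "finite S" using fV assms(2) finite_subset by blast
  have "min_degree (r - 1) G \<le> degree G S"
    unfolding min_degree_def using fV assms(2,3) by (intro Min_le) auto
  also have "degree G S \<le> card ((\<lambda>w. insert w S) ` ?A)"
    unfolding degree_def
  proof (rule card_mono)
    show "{e \<in> edges G. S \<subseteq> e} \<subseteq> (\<lambda>w. insert w S) ` ?A"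
    proof
      fix e assume e: "e \<in> {e \<in> edges G. S \<subseteq> e}"
      then have "card (e - S) = 1" using E fS assms by (auto simp: card_Diff_subset)
      then obtain w where "e - S = {w}" by (auto simp: card_1_singleton_iff)
      then have "e = insert w S" "w \<notin> S" "w \<in> e" using e by auto
      then show "e \<in> (\<lambda>w. insert w S) ` ?A" using e E by auto
    qed
  qed (use fV in auto)
  also have "\<dots> \<le> card ?A" using fV by (intro card_image_le) auto
  finally have "min_degree (r - 1) G \<le> card ?A" .
  moreover have "card ?A + card ?B = card (?V - S)"
    using fV by (subst card_Un_disjoint[symmetric]) (auto intro: arg_cong[of _ _ card])
  moreover have "card (?V - S) + card S = card ?V"
    using fV fS assms(2) by (simp add: card_Diff_subset card_mono)
  ultimately show ?thesis using assms(3) by linarith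
qed

text \<open>The link of \<open>v\<close> in the complement of \<open>G\<close>: an (r - 1)-uniform
  family, to which the chain lemmas apply with j = r - 2.\<close>

definition missing_link :: "nat \<Rightarrow> 'a hypergraph \<Rightarrow> 'a \<Rightarrow> 'a set set" where
  "missing_link r G v = {f. f \<subseteq> verts G - {v} \<and> card f = r - 1 \<and> insert v f \<notin> edges G}"

text \<open>Each \<open>w\<close> counted completes the (r - 1)-set \<open>insert v g\<close> to a
  non-edge, so the degree condition on that set applies. If \<open>v \<in> g\<close> there is no
  such \<open>w\<close>, since link sets avoid \<open>v\<close>.\<close>

lemma missing_link_degree:
  assumes "r_graph r G" "v \<in> verts G" "r \<ge> 2" "g \<subseteq> verts G" "card g = r - 2"
    and "real (min_degree (r - 1) G) \<ge> (1 - d) * real (card (verts G))" "d \<ge> 0"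
  shows "real (card {w \<in> verts G - g. insert w g \<in> missing_link r G v}) \<le> d * real (card (verts G))"
proof (cases "v \<in> g")
  case True
  then have *: "{w \<in> verts G - g. insert w g \<in> missing_link r G v} = {}"
    by (auto simp: missing_link_def)
  show ?thesis using assms(7) unfolding * by simp
next
  case False
  let ?S = "insert v g"
  have "finite g" using assms finite_subset by (auto simp: r_graph_def)
  then have S: "?S \<subseteq> verts G" "card ?S = r - 1" using assms False by auto
  have "{w \<in> verts G - g. insert w g \<in> missing_link r G v} \<subseteq>
      {w \<in> verts G - ?S. insert w ?S \<notin> edges G}"
    by (auto simp: missing_link_def insert_commute)
  then have "card {w \<in> verts G - g. insert w g \<in> missing_link r G v}
      \<le> card {w \<in> verts G - ?S. insert w ?S \<notin> edges G}"
    using assms by (intro card_mono) (auto simp: r_graph_def)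
  then have "card {w \<in> verts G - g. insert w g \<in> missing_link r G v} + min_degree (r - 1) G
      \<le> card (verts G)"
    using card_non_neighbours_le[OF assms(1) S] assms(3) by linarith
  then show ?thesis using assms(6) by (simp add: algebra_simps)
qed

text \<open>Deleting \<open>v\<close> is injective on the non-edges through \<open>v\<close>, and
  since \<open>H\<close> is induced, its non-edges are non-edges of \<open>G\<close>.\<close>

lemma degree_complement_le:
  assumes "r_graph r G" "induced_subgraph H G" "v \<in> verts H"
  shows "degree (complement r H) {v} \<le> card {f \<in> missing_link r G v. f \<subseteq> verts H}"
proof -
  have fH: "finite (verts H)"
    using assms finite_subset by (auto simp: r_graph_def induced_subgraph_def)
  let ?E = "{e \<in> edges (complement r H). {v} \<subseteq> e}"
  have "inj_on (\<lambda>e. e - {v}) ?E"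
    by (rule inj_on_inverseI[where g = "insert v"]) auto
  moreover have "(\<lambda>e. e - {v}) ` ?E \<subseteq> {f \<in> missing_link r G v. f \<subseteq> verts H}"
  proof
    fix f assume "f \<in> (\<lambda>e. e - {v}) ` ?E"
    then obtain e where e: "e \<subseteq> verts H" "card e = r" "e \<notin> edges H" "v \<in> e" "f = e - {v}"
      by (auto simp: complement_def)
    then have "card f = r - 1" "insert v f = e" by auto
    then show "f \<in> {f \<in> missing_link r G v. f \<subseteq> verts H}"
      using e assms(2) by (auto simp: missing_link_def induced_subgraph_def)
  qed
  ultimately show ?thesis
    unfolding degree_def using fH
    by (intro card_inj_on_le) auto
qed

text \<open>The premise rules out truncation by \<open>nat\<close>; for x \<le> -1 the bound would
  fail.\<close>

lemma real_nat_ceiling_less: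
  fixes x :: real
  assumes "nat \<lceil>x\<rceil> \<noteq> 0"
  shows "real (nat \<lceil>x\<rceil>) < x + 1"
  using assms by linarith

text \<open>More than \<open>m\<close> sets of size r - 1 need a union \<open>?U\<close> of more
  than \<open>?t\<close> vertices, of which at most \<open>r\<close> lie in \<open>e\<close>. The
  greedy lemma then applies because (r - 1) * (s - 1) < ?t - r whenever s > 0.\<close>

lemma edge_chain_of_missing_link:
  assumes G: "r_graph r G" "r \<ge> 2" and K: "K \<subseteq> verts G" and e: "finite e" "card e = r"
    and large: "m < card {f \<in> missing_link r G v. f \<subseteq> K}"
    and s: "s = nat \<lceil>(real m powr (1 / real (r - 1)) - real r) / real (r - 1)\<rceil>"
  shows "edge_chain (missing_link r G v) K s (insert v e)"
proof (rule edge_chain_greedy[where c = "r - 1"])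
  let ?L = "missing_link r G v"
  let ?U = "\<Union>{f \<in> ?L. f \<subseteq> K}"
  let ?t = "real m powr (1 / real (r - 1))"
  show fU: "finite ?U"
    using G K by (intro finite_subset[of ?U "verts G"]) (auto simp: r_graph_def)
  show "card f = r - 1" if "f \<in> ?L" for f using that by (simp add: missing_link_def)
  have "m < card ?U ^ (r - 1)"
  proof (rule less_le_trans[OF large])
    show "card {f \<in> ?L. f \<subseteq> K} \<le> card ?U ^ (r - 1)"
      using fU by (rule card_uniform_le_power) (auto simp: missing_link_def)
  qed
  then have "real m < real (card ?U) ^ (r - 1)"
    by (metis of_nat_less_iff of_nat_power)
  then have "?t < (real (card ?U) ^ (r - 1)) powr (1 / real (r - 1))"
    using G(2) by (intro powr_less_mono2) auto
  also have "\<dots> = real (card ?U)"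
    using G(2) by (simp add: powr_powr flip: powr_realpow')
  finally have t: "?t < real (card ?U)" .
  \<comment> \<open>No member of the link contains \<open>v\<close>, so starting the chain at
    \<open>insert v e\<close> instead of \<open>e\<close> loses no vertex of
    \<open>?U\<close>.\<close>
  have "?U - e \<subseteq> ?U - insert v e" by (auto simp: missing_link_def)
  then have "card (?U - e) \<le> card (?U - insert v e)" using fU by (intro card_mono) auto
  moreover have "card ?U - card e \<le> card (?U - e)" using e(1) by (rule diff_card_le_card_Diff)
  ultimately have U: "card ?U \<le> card (?U - insert v e) + r" using e(2) by linarith
  show "(r - 1) * s < card (?U - insert v e) + (r - 1)"
  proof (cases "s = 0")
    case True
    then show ?thesis using G(2) by simp
  next
    case False
    then have "real s < (?t - real r) / real (r - 1) + 1"
      unfolding s using real_nat_ceiling_less by simp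
    then have "real (r - 1) * real s < ?t - real r + real (r - 1)"
      using G(2) by (simp add: field_simps)
    also have "\<dots> < real (card (?U - insert v e) + (r - 1))"
      using t U by simp
    finally show ?thesis by (metis of_nat_less_iff of_nat_mult)
  qed
qed

section \<open>The uniform weighting and its defect at an edge\<close>

theorem theorem4p2:
  fixes G :: "'a hypergraph" and r m k n :: nat and d :: real and \<H> :: "'a hypergraph set"
  assumes "r \<ge> 2" and "m \<ge> r" and "k \<ge> r"
    and "r_graph r G" and "card (verts G) = n"
    and "real (min_degree (r - 1) G) \<ge> (1 - d) * real n"
    and "d \<le> 1 / (2 * (exp 1)\<^sup>2 * real k) ^ (r - 1)"
    and "\<H> = {H. induced_subgraph H G \<and> card (verts H) = k
                  \<and> max_degree 1 (complement r H) \<le> m}"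
  shows "\<exists>\<phi>. almost_fractional_decomposition
           (real k * ((2 * (exp 1)\<^sup>2 * real k) ^ (r - 1) * d)
              powr ((real m powr (1 / real (r - 1)) - real r) / real (r - 1)))
           G \<H> \<phi>"
\<comment> \<open>An edge forces r \<le> n, so that sets of size r - 1 exist and
  \<open>min_degree\<close> is a genuine minimum.\<close>
proof (cases "edges G = {}")
  case True
  then show ?thesis
    by (auto simp: almost_fractional_decomposition_def fractional_packing_def)
next
  case False
  define V where "V = verts G"
  define y where "y = (real m powr (1 / real (r - 1)) - real r) / real (r - 1)"
  define s where "s = nat \<lceil>y\<rceil>"
  define B where "B = 2 * (exp 1)\<^sup>2 * real k"
  define Q where "Q = B ^ (r - 1) * d"
  define q where "q = d * real (k * (k choose (r - 2)))"
  define \<phi> :: "'a hypergraph \<Rightarrow> real" where "\<phi> = (\<lambda>H. 1 / real ((n - r) choose (k - r)))"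
  have fV: "finite V" and nV: "card V = n" and E: "\<And>e. e \<in> edges G \<Longrightarrow> e \<subseteq> V \<and> card e = r"
    using assms by (auto simp: r_graph_def V_def)
  obtain e0 where e0: "e0 \<in> edges G" using False by auto
  then have rn: "r \<le> n" using E fV nV card_mono by metis
  have k0: "k > 0" using assms by simp
  \<comment> \<open>An (r - 1)-set has degree at most n - (r - 1). Compared with the degree
    hypothesis, this bounds \<open>d\<close> from below and makes it positive.\<close>
  have dn: "real (r - 1) \<le> d * real n"
  proof -
    have "r - 1 \<le> card V" using rn nV by simp
    then obtain S where "S \<subseteq> V" "card S = r - 1"
      by (rule obtain_subset_with_card_n)
    then have "min_degree (r - 1) G + (r - 1) \<le> n"
      using card_non_neighbours_le[OF assms(4), of S] assms(1,5) by (simp add: V_def)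
    then have "real (min_degree (r - 1) G) + real (r - 1) \<le> real n" by linarith
    then show ?thesis using assms(6) by (simp add: algebra_simps)
  qed
  then have "0 < d * real n" using assms(1) by simp
  then have d0: "d > 0" using zero_less_mult_pos2[of d "real n"] rn assms(1) by simp
  have "1 \<le> exp (1::real)" by simp
  then have "1 \<le> (exp (1::real))\<^sup>2" by (rule one_le_power)
  then have "1 \<le> 2 * (exp (1::real))\<^sup>2" by linarith
  then have "1 * real k \<le> (2 * (exp 1)\<^sup>2) * real k" by (rule mult_right_mono) simp
  then have Bk: "real k \<le> B" by (simp add: B_def)
  then have B1: "1 \<le> B" using k0 by linarith
  have Q0: "Q > 0" using d0 B1 by (simp add: Q_def)
  have Q1: "Q \<le> 1" using assms(7) B1 unfolding Q_def B_def[symmetric]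
    by (simp add: field_simps)
  \<comment> \<open>The chain is k * d \<le> Q \<le> 1 \<le> r - 1 \<le> d * n, and \<open>d\<close>
    cancels. Thus \<open>k\<close>-sets containing a given edge exist.\<close>
  have kn: "k \<le> n"
  proof -
    have "B ^ 1 \<le> B ^ (r - 1)" using B1 assms(1) by (intro power_increasing) auto
    then have "real k * d \<le> Q" using Bk d0 by (auto simp: Q_def intro!: mult_right_mono)
    also have "\<dots> \<le> d * real n" using Q1 dn assms(1) by simp
    finally show ?thesis using d0 by (simp add: mult.commute)
  qed
  have qQ: "q \<le> Q"
  proof -
    have "k choose (r - 2) \<le> k ^ (r - 2)" using assms(1,3) by (intro binomial_le_pow) simp
    then have "k * (k choose (r - 2)) \<le> k * k ^ (r - 2)" by simp
    also have "\<dots> = k ^ (r - 1)"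
      using assms(1) by (metis One_nat_def Suc_1 Suc_diff_le diff_Suc_Suc power_Suc)
    finally have "real (k * (k choose (r - 2))) \<le> real k ^ (r - 1)"
      by (metis of_nat_le_iff of_nat_power)
    also have "\<dots> \<le> B ^ (r - 1)" using Bk by (intro power_mono) auto
    finally show ?thesis using d0 by (simp add: q_def Q_def)
  qed
  have q0: "q \<ge> 0" using d0 by (simp add: q_def)
  \<comment> \<open>Since Q \<le> 1, rounding the exponent \<open>y\<close> up to \<open>s\<close>
    only decreases the power. This also covers negative \<open>y\<close>, where s = 0.\<close>
  have "q ^ s \<le> Q ^ s" using qQ q0 by (rule power_mono)
  also have "\<dots> = Q powr real s" using Q0 by (simp add: powr_realpow)
  also have "\<dots> \<le> Q powr y"
    using Q0 Q1 by (intro powr_mono') (simp_all add: s_def real_nat_ceiling_ge)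
  finally have qs: "q ^ s \<le> Q powr y" .
  have N0: "(n - r) choose (k - r) > 0" using kn by simp
  have weight: "edge_weight \<H> \<phi> e \<in> {1 - real k * Q powr y..1}" if e: "e \<in> edges G" for e
  proof -
    let ?N = "real ((n - r) choose (k - r))"
    \<comment> \<open>An induced subgraph is determined by its vertex set, so the weight at
      \<open>e\<close> becomes a count of \<open>k\<close>-sets.\<close>
    define good where "good = verts ` {H \<in> \<H>. e \<in> edges H}"
    define bad where "bad = (\<lambda>v. {K \<in> supersets V k (insert v e).
      edge_chain (missing_link r G v) K s (insert v e)})"
    have eV: "e \<subseteq> V" "card e = r" using E e by auto
    then have fe: "finite e" using fV finite_subset by blast
    have N: "card (supersets V k e) = (n - r) choose (k - r)"
      using card_supersets[OF fV eV(1), of k] eV assms(3) nV by simp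
    have inj: "inj_on verts {H \<in> \<H>. e \<in> edges H}"
      unfolding assms(8) induced_subgraph_def by (intro inj_onI) (auto intro: hypergraph.equality)
    have w: "edge_weight \<H> \<phi> e = real (card good) / ?N"
      unfolding edge_weight_def \<phi>_def good_def by (simp add: card_image[OF inj])
    have good: "good \<subseteq> supersets V k e"
      by (auto simp: good_def assms(8) induced_subgraph_def supersets_def V_def)
    then have "card good \<le> card (supersets V k e)" using fV by (intro card_mono) auto
    then have upper: "edge_weight \<H> \<phi> e \<le> 1" using N0 N by (simp add: w)
    have "supersets V k e - good \<subseteq> (\<Union>v\<in>V. bad v)"
    proof
      fix K assume K: "K \<in> supersets V k e - good"
      then have KV: "e \<subseteq> K" "K \<subseteq> V" "card K = k" by (auto simp: supersets_def)
      \<comment> \<open>The subgraph induced on \<open>K\<close> can fail to be in \<H> only through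
        its complement degree, which yields the vertex \<open>v\<close>.\<close>
      define H where "H = \<lparr>verts = K, edges = {e \<in> edges G. e \<subseteq> K}\<rparr>"
      have H: "induced_subgraph H G" "verts H = K" "e \<in> edges H"
        using KV e by (auto simp: H_def induced_subgraph_def V_def)
      then have "H \<notin> \<H>" using K by (auto simp: good_def)
      then have "m < max_degree 1 (complement r H)" using H KV by (simp add: assms(8))
      moreover have "finite K" using KV fV finite_subset by blast
      moreover have "verts (complement r H) = K" using H by (simp add: complement_def)
      moreover have "{S. S \<subseteq> K \<and> card S = 1} = (\<lambda>v. {v}) ` K"
        by (auto simp: card_1_singleton_iff)
      moreover have "K \<noteq> {}" using KV k0 by auto
      ultimately obtain v where v: "v \<in> K" "m < degree (complement r H) {v}"
        by (auto simp: max_degree_def Max_gr_iff)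
      then have "m < card {f \<in> missing_link r G v. f \<subseteq> K}"
        using degree_complement_le[OF assms(4) H(1), of v] H(2) by auto
      then have "edge_chain (missing_link r G v) K s (insert v e)"
        using assms(1,4) KV eV fe
        by (intro edge_chain_of_missing_link[where m = m]) (auto simp: V_def s_def y_def)
      then show "K \<in> (\<Union>v\<in>V. bad v)" using v KV by (auto simp: bad_def supersets_def)
    qed
    then have "card (supersets V k e - good) \<le> card (\<Union>v\<in>V. bad v)"
      using fV by (intro card_mono) (auto simp: bad_def)
    also have "\<dots> \<le> (\<Sum>v\<in>V. card (bad v))" by (rule card_UN_le[OF fV])
    finally have "real (card (supersets V k e - good)) \<le> (\<Sum>v\<in>V. real (card (bad v)))"
      unfolding of_nat_sum[symmetric] of_nat_le_iff .
    also have "\<dots> \<le> (\<Sum>v\<in>V. q ^ s * real (card (supersets V k (insert v e))))"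
    proof (rule sum_mono)
      fix v assume v: "v \<in> V"
      show "real (card (bad v)) \<le> q ^ s * real (card (supersets V k (insert v e)))"
        unfolding bad_def q_def
      proof (rule card_edge_chain_le)
        show "f \<subseteq> V \<and> card f = Suc (r - 2)" if "f \<in> missing_link r G v" for f
          using that assms(1) by (auto simp: missing_link_def V_def)
        show "real (card {w \<in> V - g. insert w g \<in> missing_link r G v}) \<le> d * real (card V)"
          if "g \<subseteq> V" "card g = r - 2" for g
          using that v missing_link_degree[OF assms(4) _ assms(1), of v g d] assms(5,6) d0
          by (simp add: V_def)
      qed (use fV nV kn k0 d0 v eV in auto)
    qed
    also have "\<dots> = q ^ s * real (\<Sum>v\<in>V. card (supersets V k (insert v e)))"
      by (simp add: sum_distrib_left)
    \<comment> \<open>Because \<open>bad v\<close> only counts sets \<open>K\<close> that contain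
      \<open>v\<close>, the union bound over all of \<open>V\<close> costs a factor \<open>k\<close>
      and not \<open>n\<close>.\<close>
    also have "(\<Sum>v\<in>V. card (supersets V k (insert v e))) = k * card (supersets V k e)"
    proof -
      have sup: "supersets V k (insert v e) = {K \<in> supersets V k e. v \<in> K}" for v
        by (auto simp: supersets_def)
      have "\<forall>K\<in>supersets V k e. card {v \<in> V. v \<in> K} = k"
        by (auto simp: supersets_def intro!: arg_cong[of _ _ card])
      then show ?thesis
        unfolding sup using fV by (intro sum_multicount) auto
    qed
    finally have "real (card (supersets V k e - good)) \<le> q ^ s * (real k * ?N)"
      by (simp add: N)
    also have "\<dots> \<le> Q powr y * (real k * ?N)" using qs by (intro mult_right_mono) auto
    finally have "real (card (supersets V k e - good)) \<le> Q powr y * (real k * ?N)" .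
    moreover have "card (supersets V k e - good) + card good = card (supersets V k e)"
      using good fV by (metis card_Diff_subset card_mono finite_subset finite_supersets le_add_diff_inverse2)
    ultimately have "?N \<le> real (card good) + Q powr y * (real k * ?N)" using N by linarith
    then have "1 - real k * Q powr y \<le> edge_weight \<H> \<phi> e"
      using N0 by (simp add: w field_simps)
    then show ?thesis using upper by simp
  qed
  have "edge_weight \<H> \<phi> e \<ge> 0" for e
    unfolding edge_weight_def \<phi>_def by (intro sum_nonneg) simp
  then have "almost_fractional_decomposition (real k * Q powr y) G \<H> \<phi>"
    using weight by (auto simp: almost_fractional_decomposition_def fractional_packing_def \<phi>_def)
  then show ?thesis unfolding Q_def y_def B_def by blast
qed

end
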